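(* Let $(M^n,g)$ be an $n$-dimensional Riemannian manifold, let $f>0$ be a smooth function on $M$, and let $\tilde M = M\times_f \mathbb{R}$ be a vacuum static spacetime with metric $\tilde g = g - f^2dt^2$. If $(\tilde g,\tilde\lambda,\tilde\phi)$ is an almost gradient Ricci soliton on $\tilde M$ and $H^{\tilde\phi}(\partial_t,\partial_t)=0$, then the almost gradient Ricci soliton is steady, i.e. $\tilde\lambda=0$.
   Context: An almost gradient Ricci soliton $(\tilde g,\tilde\lambda,\tilde\phi)$ on a semi-Riemannian manifold $(\tilde M,\tilde g)$ consists of smooth functions $\tilde\phi,\tilde\lambda$ on $\tilde M$ with $H^{\tilde\phi}+\tilde S+\tilde\lambda\tilde g=0$, where $H^{\tilde\phi}$ is the Hessian of $\tilde\phi$ with respect to $\tilde g$ and $\tilde S$ is the Ricci tensor of $\tilde g$. It is steady if $\tilde\lambda=0$. The static spacetime $M\times_f\mathbb{R}$ is $M\times\mathbb{R}$ with the Lorentzian metric $\tilde g=g-f^2dt^2$, $t$ being the coordinate on $\mathbb{R}$. It is a vacuum static spacetime if the static vacuum Einstein equations $fS=H^f$ and $\triangle f=0$ hold on $M$, where $S$ is the Ricci tensor of $g$, and $H^f$ and $\triangle f$ are the Hessian and the Laplacian (trace of the Hessian) of $f$ on $(M,g)$. *)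

theory Defs
  imports "HOL-Analysis.Analysis"
begin

section \<open>Smooth functions on open subsets of a Euclidean space\<close>

primrec Ck_on :: "nat \<Rightarrow> 'a::euclidean_space set \<Rightarrow> ('a \<Rightarrow> 'b::euclidean_space) \<Rightarrow> bool" where
  "Ck_on 0 U h \<longleftrightarrow> continuous_on U h"
| "Ck_on (Suc k) U h \<longleftrightarrow>
     (\<forall>x\<in>U. h differentiable (at x)) \<and> (\<forall>v. Ck_on k U (\<lambda>x. frechet_derivative h (at x) v))"

definition smooth_on :: "'a::euclidean_space set \<Rightarrow> ('a \<Rightarrow> 'b::euclidean_space) \<Rightarrow> bool" where
  "smooth_on U h \<longleftrightarrow> (\<forall>k. Ck_on k U h)"

section \<open>Smooth manifolds\<close>

text \<open>
  A manifold modelled on the Euclidean space \<open>'e\<close> is an abstract topological space with an atlas,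
  i.e. a family of charts indexed by a set \<open>index\<close>; its dimension is \<open>DIM('e)\<close>.  The atlas need
  not be maximal.  The index type is arbitrary, so every atlas is covered (index it by itself).
\<close>

record ('i, 'm, 'e) manifold_data =
  points :: "'m topology"
  index :: "'i set"
  chart_dom :: "'i \<Rightarrow> 'm set"
  chart :: "'i \<Rightarrow> 'm \<Rightarrow> 'e"

definition chart_image :: "('i, 'm, 'e) manifold_data \<Rightarrow> 'i \<Rightarrow> 'e set" where
  "chart_image M i = chart M i ` chart_dom M i"

definition chart_inv :: "('i, 'm, 'e) manifold_data \<Rightarrow> 'i \<Rightarrow> 'e \<Rightarrow> 'm" where
  "chart_inv M i = inv_into (chart_dom M i) (chart M i)"

definition transition :: "('i, 'm, 'e) manifold_data \<Rightarrow> 'i \<Rightarrow> 'i \<Rightarrow> 'e \<Rightarrow> 'e" where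
  "transition M i j = chart M j \<circ> chart_inv M i"

definition smooth_manifold :: "('i, 'm, 'e::euclidean_space) manifold_data \<Rightarrow> bool" where
  "smooth_manifold M \<longleftrightarrow>
     Hausdorff_space (points M) \<and> second_countable (points M) \<and>
     topspace (points M) = (\<Union>i\<in>index M. chart_dom M i) \<and>
     (\<forall>i\<in>index M. openin (points M) (chart_dom M i) \<and> open (chart_image M i) \<and>
        homeomorphic_map (subtopology (points M) (chart_dom M i)) (top_of_set (chart_image M i)) (chart M i)) \<and>
     (\<forall>i\<in>index M. \<forall>j\<in>index M. smooth_on (chart M i ` (chart_dom M i \<inter> chart_dom M j)) (transition M i j))"

definition smooth_function :: "('i, 'm, 'e::euclidean_space) manifold_data \<Rightarrow> ('m \<Rightarrow> real) \<Rightarrow> bool" where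
  "smooth_function M h \<longleftrightarrow> (\<forall>i\<in>index M. smooth_on (chart_image M i) (h \<circ> chart_inv M i))"

section \<open>Metrics\<close>

text \<open>
  A covariant 2-tensor field \<open>B\<close> is given by its components in the charts: \<open>B i p v w\<close> is the value
  at the point \<open>p \<in> chart_dom M i\<close> on the two tangent vectors whose components in the chart \<open>i\<close> are
  \<open>v\<close> and \<open>w\<close>.  An identity between tensors is the identity of their components in all charts.
\<close>

type_synonym ('i, 'm, 'e) tensor2 = "'i \<Rightarrow> 'm \<Rightarrow> 'e \<Rightarrow> 'e \<Rightarrow> real"

definition tensor_rep ::
  "('i, 'm, 'e) manifold_data \<Rightarrow> ('i, 'm, 'e) tensor2 \<Rightarrow> 'i \<Rightarrow> 'e \<Rightarrow> 'e \<Rightarrow> 'e \<Rightarrow> real" where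
  "tensor_rep M B i x = B i (chart_inv M i x)"

definition smooth_tensor2 ::
  "('i, 'm, 'e::euclidean_space) manifold_data \<Rightarrow> ('i, 'm, 'e) tensor2 \<Rightarrow> bool" where
  "smooth_tensor2 M B \<longleftrightarrow>
     (\<forall>i\<in>index M. \<forall>p\<in>chart_dom M i. bilinear (B i p)) \<and>
     (\<forall>i\<in>index M. \<forall>v w. smooth_on (chart_image M i) (\<lambda>x. tensor_rep M B i x v w)) \<and>
     (\<forall>i\<in>index M. \<forall>j\<in>index M. \<forall>p\<in>chart_dom M i \<inter> chart_dom M j. \<forall>v w.
        B i p v w = B j p (frechet_derivative (transition M i j) (at (chart M i p)) v)
                          (frechet_derivative (transition M i j) (at (chart M i p)) w))"

definition riemannian_metric ::
  "('i, 'm, 'e::euclidean_space) manifold_data \<Rightarrow> ('i, 'm, 'e) tensor2 \<Rightarrow> bool" where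
  "riemannian_metric M g \<longleftrightarrow>
     smooth_tensor2 M g \<and>
     (\<forall>i\<in>index M. \<forall>p\<in>chart_dom M i. (\<forall>v w. g i p v w = g i p w v) \<and> (\<forall>v. v \<noteq> 0 \<longrightarrow> g i p v v > 0))"

section \<open>Levi-Civita connection, curvature and Hessian in a chart\<close>

text \<open>
  Here \<open>G x v w\<close> is a symmetric nondegenerate bilinear form in \<open>v\<close>, \<open>w\<close> depending smoothly on the
  point \<open>x\<close> of an open subset of \<open>'e\<close>; the signature is arbitrary.  A vector \<open>v :: 'e\<close> also stands
  for the constant (coordinate) vector field \<open>v\<close>.
\<close>

text \<open>
  The vector metrically equivalent to the covector \<open>\<omega>\<close>; it exists and is unique because \<open>B\<close> is
  nondegenerate and \<open>\<omega>\<close> is linear in all uses below.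
\<close>

definition sharp :: "('e::euclidean_space \<Rightarrow> 'e \<Rightarrow> real) \<Rightarrow> ('e \<Rightarrow> real) \<Rightarrow> 'e" where
  "sharp B \<omega> = (THE z. \<forall>u. B z u = \<omega> u)"

text \<open>\<open>christoffel G x v w\<close> is \<open>\<nabla>\<^sub>v w\<close> at \<open>x\<close>, by the Koszul formula for constant (hence commuting) fields.\<close>

definition christoffel ::
  "('e::euclidean_space \<Rightarrow> 'e \<Rightarrow> 'e \<Rightarrow> real) \<Rightarrow> 'e \<Rightarrow> 'e \<Rightarrow> 'e \<Rightarrow> 'e" where
  "christoffel G x v w = sharp (G x) (\<lambda>u.
     (frechet_derivative (\<lambda>y. G y w u) (at x) v
      + frechet_derivative (\<lambda>y. G y v u) (at x) w
      - frechet_derivative (\<lambda>y. G y v w) (at x) u) / 2)"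

definition cov_deriv ::
  "('e::euclidean_space \<Rightarrow> 'e \<Rightarrow> 'e \<Rightarrow> real) \<Rightarrow> 'e \<Rightarrow> ('e \<Rightarrow> 'e) \<Rightarrow> 'e \<Rightarrow> 'e" where
  "cov_deriv G v Y x = frechet_derivative Y (at x) v + christoffel G x v (Y x)"

text \<open>\<open>R(u,v)w = \<nabla>\<^sub>u \<nabla>\<^sub>v w - \<nabla>\<^sub>v \<nabla>\<^sub>u w\<close>; the term with the bracket of the constant fields \<open>u\<close>, \<open>v\<close> vanishes.\<close>

definition curvature ::
  "('e::euclidean_space \<Rightarrow> 'e \<Rightarrow> 'e \<Rightarrow> real) \<Rightarrow> 'e \<Rightarrow> 'e \<Rightarrow> 'e \<Rightarrow> 'e \<Rightarrow> 'e" where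
  "curvature G x u v w =
     cov_deriv G u (cov_deriv G v (\<lambda>_. w)) x - cov_deriv G v (cov_deriv G u (\<lambda>_. w)) x"

text \<open>
  Trace of the linear map \<open>u \<mapsto> R(u,v)w\<close>, so that round spheres have positive Ricci curvature.
  The trace of an endomorphism may be taken in the standard basis of \<open>'e\<close> whatever the metric is.
\<close>

definition ricci_rep ::
  "('e::euclidean_space \<Rightarrow> 'e \<Rightarrow> 'e \<Rightarrow> real) \<Rightarrow> 'e \<Rightarrow> 'e \<Rightarrow> 'e \<Rightarrow> real" where
  "ricci_rep G x v w = (\<Sum>b\<in>Basis. curvature G x b v w \<bullet> b)"

text \<open>\<open>H\<^sup>h(v,w) = v(w(h)) - (\<nabla>\<^sub>v w)(h)\<close>\<close>

definition hessian_rep ::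
  "('e::euclidean_space \<Rightarrow> 'e \<Rightarrow> 'e \<Rightarrow> real) \<Rightarrow> ('e \<Rightarrow> real) \<Rightarrow> 'e \<Rightarrow> 'e \<Rightarrow> 'e \<Rightarrow> real" where
  "hessian_rep G h x v w =
     frechet_derivative (\<lambda>y. frechet_derivative h (at y) w) (at x) v
     - frechet_derivative h (at x) (cov_deriv G v (\<lambda>_. w) x)"

text \<open>
  Trace of \<open>C\<close> with respect to the metric \<open>B\<close>, i.e. of the endomorphism \<open>A\<close> with \<open>B (A v) w = C v w\<close>.
\<close>

definition metric_trace ::
  "('e::euclidean_space \<Rightarrow> 'e \<Rightarrow> real) \<Rightarrow> ('e \<Rightarrow> 'e \<Rightarrow> real) \<Rightarrow> real" where
  "metric_trace B C = (\<Sum>b\<in>Basis. sharp B (C b) \<bullet> b)"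

section \<open>Ricci tensor, Hessian and Laplacian on a manifold\<close>

definition ricci ::
  "('i, 'm, 'e::euclidean_space) manifold_data \<Rightarrow> ('i, 'm, 'e) tensor2 \<Rightarrow> ('i, 'm, 'e) tensor2" where
  "ricci M g i p = ricci_rep (tensor_rep M g i) (chart M i p)"

definition hessian ::
  "('i, 'm, 'e::euclidean_space) manifold_data \<Rightarrow> ('i, 'm, 'e) tensor2 \<Rightarrow> ('m \<Rightarrow> real)
     \<Rightarrow> ('i, 'm, 'e) tensor2" where
  "hessian M g h i p = hessian_rep (tensor_rep M g i) (h \<circ> chart_inv M i) (chart M i p)"

text \<open>The value of the Laplacian at \<open>p\<close>, computed in the chart \<open>i\<close> around \<open>p\<close>.\<close>

definition laplacian ::
  "('i, 'm, 'e::euclidean_space) manifold_data \<Rightarrow> ('i, 'm, 'e) tensor2 \<Rightarrow> ('m \<Rightarrow> real)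
     \<Rightarrow> 'i \<Rightarrow> 'm \<Rightarrow> real" where
  "laplacian M g h i p = metric_trace (g i p) (hessian M g h i p)"

section \<open>Almost gradient Ricci solitons\<close>

definition almost_gradient_ricci_soliton ::
  "('i, 'm, 'e::euclidean_space) manifold_data \<Rightarrow> ('i, 'm, 'e) tensor2
     \<Rightarrow> ('m \<Rightarrow> real) \<Rightarrow> ('m \<Rightarrow> real) \<Rightarrow> bool" where
  "almost_gradient_ricci_soliton M g l \<phi> \<longleftrightarrow>
     smooth_function M \<phi> \<and> smooth_function M l \<and>
     (\<forall>i\<in>index M. \<forall>p\<in>chart_dom M i. \<forall>v w.
        hessian M g \<phi> i p v w + ricci M g i p v w + l p * g i p v w = 0)"

definition steady :: "('i, 'm, 'e) manifold_data \<Rightarrow> ('m \<Rightarrow> real) \<Rightarrow> bool" where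
  "steady M l \<longleftrightarrow> (\<forall>p\<in>topspace (points M). l p = 0)"

section \<open>Static spacetimes\<close>

text \<open>
  The product manifold \<open>M \<times> \<real>\<close> carries the product charts \<open>(p, t) \<mapsto> (chart M i p, t)\<close>, indexed as
  those of \<open>M\<close>.
\<close>

definition times_line :: "('i, 'm, 'e) manifold_data \<Rightarrow> ('i, 'm \<times> real, 'e \<times> real) manifold_data" where
  "times_line M = \<lparr>points = prod_topology (points M) euclideanreal, index = index M,
     chart_dom = (\<lambda>i. chart_dom M i \<times> UNIV), chart = (\<lambda>i. map_prod (chart M i) id)\<rparr>"

text \<open>\<open>g - f\<^sup>2 dt\<^sup>2\<close>\<close>

definition static_metric ::
  "('i, 'm, 'e) tensor2 \<Rightarrow> ('m \<Rightarrow> real) \<Rightarrow> ('i, 'm \<times> real, 'e \<times> real) tensor2" where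
  "static_metric g f i q v w = g i (fst q) (fst v) (fst w) - (f (fst q))\<^sup>2 * (snd v * snd w)"

text \<open>The components of the coordinate vector field \<open>\<partial>\<^sub>t\<close>, the same in every product chart.\<close>

definition partial_t :: "'e::zero \<times> real" where
  "partial_t = (0, 1)"

definition vacuum_static ::
  "('i, 'm, 'e::euclidean_space) manifold_data \<Rightarrow> ('i, 'm, 'e) tensor2 \<Rightarrow> ('m \<Rightarrow> real) \<Rightarrow> bool" where
  "vacuum_static M g f \<longleftrightarrow>
     (\<forall>i\<in>index M. \<forall>p\<in>chart_dom M i.
        (\<forall>v w. f p * ricci M g i p v w = hessian M g f i p v w) \<and> laplacian M g f i p = 0)"

end

theory Submission
  imports Defs
begin

text \<open>
  The Ricci tensor of a static metric \<open>g - f\<^sup>2 dt\<^sup>2\<close> satisfies \<open>Ric(\<partial>\<^sub>t, \<partial>\<^sub>t) = f \<triangle>f\<close>, which vanishes on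
  a vacuum static spacetime.  The soliton equation evaluated on \<open>(\<partial>\<^sub>t, \<partial>\<^sub>t)\<close>, where the Hessian of
  the potential vanishes by hypothesis, therefore reduces to \<open>-f\<^sup>2 \<lambda> = 0\<close>, and \<open>f > 0\<close>.

  The formula for \<open>Ric(\<partial>\<^sub>t, \<partial>\<^sub>t)\<close> is proved in a single product chart
  (\<open>ricci_partial_t\<close>).  The Koszul formula gives the Christoffel symbols of the static metric
  (\<open>christoffel_static_metric\<close>), in particular \<open>\<nabla>\<^sub>t \<partial>\<^sub>t = f grad f\<close> and
  \<open>\<nabla>\<^sub>d \<partial>\<^sub>t = (df(d) / f) \<partial>\<^sub>t\<close> for \<open>d\<close> tangent to \<open>M\<close>, so that
  \<open>R(d, \<partial>\<^sub>t) \<partial>\<^sub>t = f \<nabla>\<^sub>d grad f\<close> (\<open>curvature_partial_t\<close>).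
  The vector \<open>\<nabla>\<^sub>d grad f\<close> is metrically equivalent to \<open>H\<^sup>f(d, -)\<close> (\<open>cov_deriv_gradF\<close>), hence the
  trace over \<open>d\<close> is \<open>f\<close> times the Laplacian.  The analytic point is that \<open>grad f\<close>, being defined
  pointwise through a linear system, is differentiable (\<open>differentiable_sharp\<close>).
\<close>

section \<open>Smooth functions\<close>

lemma smooth_on_differentiable:
  assumes "smooth_on U h" "x \<in> U"
  shows "h differentiable (at x)"
  using assms by (metis Ck_on.simps(2) smooth_on_def)

lemma smooth_on_derivative_differentiable:
  assumes "smooth_on U h" "x \<in> U"
  shows "(\<lambda>y. frechet_derivative h (at y) v) differentiable (at x)"
proof -
  have "Ck_on (Suc (Suc 0)) U h"
    using assms(1) unfolding smooth_on_def by blast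
  then show ?thesis
    using assms(2) by simp
qed

lemma smooth_on_continuous:
  assumes "smooth_on U h"
  shows "continuous_on U h"
  using assms by (metis Ck_on.simps(1) smooth_on_def)

section \<open>Musical isomorphism\<close>

lemma sharp_eqI:
  assumes lin: "bilinear B" and nondegenerate: "\<And>z. (\<And>u. B z u = 0) \<Longrightarrow> z = 0"
    and eq: "\<And>u. B z u = \<omega> u"
  shows "sharp B \<omega> = z"
  unfolding sharp_def
proof (rule the_equality)
  show "\<forall>u. B z u = \<omega> u" using eq by blast
next
  fix z' assume "\<forall>u. B z' u = \<omega> u"
  then have "B (z' - z) u = 0" for u
    using eq by (simp add: bilinear_lsub[OF lin])
  then show "z' = z"
    using nondegenerate by fastforce
qed

lemma linear_eq_inner_basis_sum:
  fixes \<omega> :: "'e::euclidean_space \<Rightarrow> real"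
  assumes "linear \<omega>"
  shows "(\<Sum>b\<in>Basis. \<omega> b *\<^sub>R b) \<bullet> u = \<omega> u"
proof -
  have "\<omega> u = \<omega> (\<Sum>b\<in>Basis. (u \<bullet> b) *\<^sub>R b)"
    by (simp add: euclidean_representation)
  also have "\<dots> = (\<Sum>b\<in>Basis. (u \<bullet> b) * \<omega> b)"
    by (simp add: linear_sum[OF assms] linear_cmul[OF assms])
  finally show ?thesis
    by (simp add: inner_sum_left inner_commute[of u] mult.commute)
qed

locale positive_definite_form =
  fixes B :: "'e::euclidean_space \<Rightarrow> 'e \<Rightarrow> real"
  assumes bilinear: "bilinear B"
    and positive: "\<And>v. v \<noteq> 0 \<Longrightarrow> B v v > 0"
begin

lemma nondegenerate: "(\<And>u. B z u = 0) \<Longrightarrow> z = 0"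
  by (metis less_irrefl positive)

lemma sharp_unique: "(\<And>u. B z u = \<omega> u) \<Longrightarrow> sharp B \<omega> = z"
  by (rule sharp_eqI[OF bilinear nondegenerate])

lemma left_linear: "linear (\<lambda>z. B z u)" and right_linear: "linear (B z)"
  using bilinear by (auto simp: bilinear_def)

lemma sharp_inner:
  assumes "linear \<omega>"
  shows "B (sharp B \<omega>) u = \<omega> u"
proof -
  define A where "A z = (\<Sum>b\<in>Basis. B z b *\<^sub>R b)" for z
  have A: "A z \<bullet> u = B z u" for z u
    unfolding A_def by (rule linear_eq_inner_basis_sum[OF right_linear])
  have linA: "linear A"
    unfolding A_def using left_linear
    by (intro linear_compose_sum ballI)
       (auto intro!: linearI simp: bilinear_ladd[OF bilinear] bilinear_lmul[OF bilinear] scaleR_left_distrib)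
  have "inj A"
    unfolding linear_injective_0[OF linA]
    by (metis A inner_zero_left nondegenerate)
  then have "surj A"
    using linA linear_injective_imp_surjective by blast
  then obtain z where z: "A z = (\<Sum>b\<in>Basis. \<omega> b *\<^sub>R b)"
    by (metis surjD)
  then have "B z u = \<omega> u" for u
    using A[of z u] linear_eq_inner_basis_sum[OF assms, of u] by simp
  then show ?thesis
    using sharp_unique[of z \<omega>] by simp
qed

lemma left_expand: "B z u = (\<Sum>c\<in>Basis. (z \<bullet> c) * B c u)"
proof -
  have "B z u = B (\<Sum>b\<in>Basis. (z \<bullet> b) *\<^sub>R b) u"
    by (simp add: euclidean_representation)
  also have "\<dots> = (\<Sum>c\<in>Basis. (z \<bullet> c) * B c u)"
    by (simp add: linear_sum[OF left_linear] linear_cmul[OF left_linear])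
  finally show ?thesis .
qed

end

text \<open>
  In coordinates \<open>sharp (B y)\<close> multiplies by the inverse of the Gram matrix \<open>A y\<close> of \<open>B y\<close>.  To
  differentiate it without a formula for the inverse matrix, consider the map
  \<open>(y, z) \<mapsto> (y, A y z)\<close> on \<open>U \<times> 'e\<close>.  It is continuous and injective, and its differential at a
  point over \<open>x\<close> is block triangular with the invertible block \<open>A x\<close>.  By the inverse function
  theorem its inverse, whose second component is \<open>sharp (B y)\<close> applied to the covector
  represented by \<open>c\<close>, is differentiable at the points \<open>(x, c)\<close>.
\<close>

lemma differentiable_sharp:
  fixes B :: "'e::euclidean_space \<Rightarrow> 'e \<Rightarrow> 'e \<Rightarrow> real"
  assumes U: "open U" "x \<in> U"
    and B: "\<And>y. y \<in> U \<Longrightarrow> positive_definite_form (B y)"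
    and contB: "\<And>v w. continuous_on U (\<lambda>y. B y v w)"
    and diffB: "\<And>v w. (\<lambda>y. B y v w) differentiable (at x)"
    and lin\<omega>: "\<And>y. y \<in> U \<Longrightarrow> linear (\<omega> y)"
    and diff\<omega>: "\<And>u. (\<lambda>y. \<omega> y u) differentiable (at x)"
  shows "(\<lambda>y. sharp (B y) (\<omega> y)) differentiable (at x)"
proof -
  define D where "D v w = frechet_derivative (\<lambda>y. B y v w) (at x)" for v w
  have D: "((\<lambda>y. B y v w) has_derivative D v w) (at x)" for v w
    unfolding D_def using diffB frechet_derivative_works by blast
  have D_fst: "((\<lambda>p. B (fst p) v w) has_derivative (\<lambda>p. D v w (fst p))) (at (x, z))"
    for v w and z :: 'e
    using has_derivative_compose[OF has_derivative_fst[OF has_derivative_ident] , of "\<lambda>y. B y v w" "D v w" "(x,z)" UNIV] D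
    by simp
  define A where "A y z = (\<Sum>b\<in>Basis. (\<Sum>c\<in>Basis. (z \<bullet> c) * B y c b) *\<^sub>R b)" for y z
  have A: "A y z \<bullet> u = B y z u" if "y \<in> U" for y z u
  proof -
    interpret positive_definite_form "B y" using B[OF that] .
    have "A y z = (\<Sum>b\<in>Basis. B y z b *\<^sub>R b)"
      unfolding A_def by (intro sum.cong refl) (simp flip: left_expand)
    then show ?thesis
      by (simp add: linear_eq_inner_basis_sum[OF right_linear])
  qed
  define S where "S y c = sharp (B y) (\<lambda>u. c \<bullet> u)" for y c
  have SA: "S y (A y z) = z" if "y \<in> U" for y z
  proof -
    interpret positive_definite_form "B y" using B[OF that] .
    show ?thesis
      unfolding S_def by (rule sharp_unique) (simp add: A[OF that])
  qed
  have AS: "A x (S x c) = c" for c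
  proof (rule vector_eq_rdot[THEN iffD1], rule allI)
    fix u
    interpret positive_definite_form "B x" using B[OF U(2)] .
    have "linear (\<lambda>u. c \<bullet> u)"
      by (simp add: bounded_linear.linear bounded_linear_inner_right)
    then show "A x (S x c) \<bullet> u = c \<bullet> u"
      by (simp add: A[OF U(2)] S_def sharp_inner)
  qed
  define \<Phi> where "\<Phi> p = (fst p, A (fst p) (snd p))" for p
  define \<Psi> where "\<Psi> p = (fst p, S (fst p) (snd p))" for p
  have left_inverse: "\<Psi> (\<Phi> p) = p" if "p \<in> U \<times> UNIV" for p
    using that SA by (cases p) (simp add: \<Phi>_def \<Psi>_def)
  have contB': "continuous_on (U \<times> UNIV) (\<lambda>p. B (fst p) c b)" for c b
    by (rule continuous_on_compose2[OF contB continuous_on_fst[OF continuous_on_id]]) auto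
  have cont\<Phi>: "continuous_on (U \<times> UNIV) \<Phi>"
    unfolding \<Phi>_def A_def by (intro continuous_intros contB')
  have inverse_diff: "\<Psi> differentiable (at (x, c))" for c
  proof -
    define z where "z = S x c"
    have z: "\<Phi> (x, z) = (x, c)"
      by (simp add: z_def \<Phi>_def AS)
    define E where "E h = (\<Sum>b\<in>Basis. (\<Sum>a\<in>Basis. (z \<bullet> a) * D a b h) *\<^sub>R b)" for h
    have "((\<lambda>p. A (fst p) (snd p)) has_derivative (\<lambda>q. E (fst q) + A x (snd q))) (at (x, z))"
      unfolding A_def E_def
      by (rule derivative_eq_intros D_fst refl)+
        (simp add: sum.distrib scaleR_left_distrib)
    then have "(\<Phi> has_derivative (\<lambda>q. (fst q, E (fst q) + A x (snd q)))) (at (x, z))"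
      unfolding \<Phi>_def by (intro has_derivative_Pair has_derivative_fst has_derivative_ident)
    \<comment> \<open>a right inverse of the block triangular differential, by back substitution\<close>
    moreover have "(\<lambda>q. (fst q, E (fst q) + A x (snd q))) \<circ> (\<lambda>q. (fst q, S x (snd q - E (fst q)))) = id"
      by (auto simp: fun_eq_iff AS)
    ultimately have "(\<Psi> has_derivative (\<lambda>q. (fst q, S x (snd q - E (fst q))))) (at (\<Phi> (x, z)))"
      using has_derivative_inverse_strong[of "U \<times> UNIV" "(x, z)" \<Phi> \<Psi>] U cont\<Phi> left_inverse
      by (simp add: open_Times)
    then show ?thesis
      using z by (auto simp: differentiable_def)
  qed
  define c where "c y = (\<Sum>b\<in>Basis. \<omega> y b *\<^sub>R b)" for y
  have "(\<lambda>y. \<omega> y b *\<^sub>R b) differentiable (at x)" for b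
    using diff\<omega>[of b] has_derivative_scaleR_left unfolding differentiable_def by blast
  then have "c differentiable (at x)"
    unfolding c_def by (intro differentiable_sum) auto
  then have "(c has_derivative frechet_derivative c (at x)) (at x)"
    using frechet_derivative_works by blast
  then have "(\<lambda>y. (y, c y)) differentiable (at x)"
    by (rule differentiableI[OF has_derivative_Pair[OF has_derivative_ident]])
  then have "(\<Psi> \<circ> (\<lambda>y. (y, c y))) differentiable (at x)"
    using inverse_diff by (rule differentiable_chain_at)
  then obtain L where "((\<Psi> \<circ> (\<lambda>y. (y, c y))) has_derivative L) (at x)"
    by (auto simp: differentiable_def)
  then have "((\<lambda>y. snd ((\<Psi> \<circ> (\<lambda>y. (y, c y))) y)) has_derivative (\<lambda>h. snd (L h))) (at x)"
    by (rule has_derivative_snd)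
  then have "((\<lambda>y. sharp (B y) (\<omega> y)) has_derivative (\<lambda>h. snd (L h))) (at x)"
    by (rule has_derivative_transform_within_open[OF _ U])
       (simp add: \<Psi>_def S_def c_def linear_eq_inner_basis_sum[OF lin\<omega>])
  then show ?thesis
    by (auto simp: differentiable_def)
qed

section \<open>Levi-Civita connection of a Riemannian metric in a chart\<close>

locale metric_chart =
  fixes U :: "'e::euclidean_space set" and G :: "'e \<Rightarrow> 'e \<Rightarrow> 'e \<Rightarrow> real"
  assumes open_U: "open U"
    and pos_def: "\<And>x. x \<in> U \<Longrightarrow> positive_definite_form (G x)"
    and sym: "\<And>x v w. x \<in> U \<Longrightarrow> G x v w = G x w v"
    and smooth: "\<And>v w. smooth_on U (\<lambda>x. G x v w)"
begin

abbreviation D_metric :: "'e \<Rightarrow> 'e \<Rightarrow> 'e \<Rightarrow> 'e \<Rightarrow> real" where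
  "D_metric x v w \<equiv> frechet_derivative (\<lambda>y. G y v w) (at x)"

lemma D_metric:
  assumes "x \<in> U"
  shows "((\<lambda>y. G y v w) has_derivative D_metric x v w) (at x)"
  using smooth_on_differentiable[OF smooth assms] frechet_derivative_works by blast

text \<open>
  The component functions are controlled only on \<open>U\<close>, so identities between them are
  differentiated through this rule, which uses that \<open>U\<close> is open.
\<close>

lemma D_metric_eqI:
  assumes "x \<in> U" "(h has_derivative h') (at x)" "\<And>y. y \<in> U \<Longrightarrow> h y = G y v w"
  shows "D_metric x v w = h'"
  using has_derivative_transform_within_open[OF assms(2) open_U assms(1) assms(3)]
  by (rule frechet_derivative_at[symmetric])

lemma D_metric_sym:
  assumes "x \<in> U"
  shows "D_metric x v w = D_metric x w v"
  by (rule D_metric_eqI[OF assms D_metric[OF assms]]) (rule sym)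

lemma linear_D_metric:
  assumes "x \<in> U"
  shows "linear (\<lambda>w. D_metric x v w d)"
proof (rule linearI)
  fix w w' :: 'e and c :: real
  have *: "linear (G y v)" if "y \<in> U" for y
    using positive_definite_form.right_linear[OF pos_def[OF that]] .
  show "D_metric x v (w + w') d = D_metric x v w d + D_metric x v w' d"
    using D_metric_eqI[OF assms has_derivative_add[OF D_metric[OF assms] D_metric[OF assms]], of v w v w' v "w + w'"]
    by (simp add: * linear_add)
  show "D_metric x v (c *\<^sub>R w) d = c *\<^sub>R D_metric x v w d"
    using D_metric_eqI[OF assms has_derivative_mult_right[OF D_metric[OF assms]], of c v w v "c *\<^sub>R w"]
    by (simp add: * linear_cmul)
qed

lemma metric_christoffel:
  assumes "x \<in> U"
  shows "G x (christoffel G x v w) u = (D_metric x w u v + D_metric x v u w - D_metric x v w u) / 2"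
  unfolding christoffel_def
proof (rule positive_definite_form.sharp_inner[OF pos_def[OF assms]])
  have "linear (D_metric x v w)"
    using linear_frechet_derivative smooth_on_differentiable[OF smooth assms] by blast
  then show "linear (\<lambda>u. (D_metric x w u v + D_metric x v u w - D_metric x v w u) / 2)"
    by (intro linearI)
      (simp_all add: linear_add linear_cmul linear_add[OF linear_D_metric[OF assms]]
        linear_cmul[OF linear_D_metric[OF assms]] field_simps)
qed

lemma metric_eqI:
  assumes x: "x \<in> U" and eq: "\<And>u. G x z u = G x z' u"
  shows "z = z'"
proof -
  interpret positive_definite_form "G x" using pos_def[OF x] .
  have "z - z' = 0"
    by (rule nondegenerate) (simp add: bilinear_lsub[OF bilinear] eq)
  then show ?thesis by simp
qed

lemma christoffel_sym:
  assumes x: "x \<in> U"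
  shows "christoffel G x v w = christoffel G x w v"
  by (rule metric_eqI[OF x]) (simp add: metric_christoffel[OF x] D_metric_sym[OF x, of v w])

lemma christoffel_scaleR:
  assumes x: "x \<in> U"
  shows "christoffel G x v (c *\<^sub>R w) = c *\<^sub>R christoffel G x v w"
proof (rule metric_eqI[OF x])
  fix u
  interpret positive_definite_form "G x" using pos_def[OF x] .
  have "D_metric x (c *\<^sub>R w) u v = c * D_metric x w u v"
    using linear_cmul[OF linear_D_metric[OF x, of u v], of c w]
    by (simp only: D_metric_sym[OF x, of _ u] real_scaleR_def)
  moreover have "D_metric x v (c *\<^sub>R w) u = c * D_metric x v w u"
    using linear_cmul[OF linear_D_metric[OF x, of v u], of c w] by simp
  moreover have "D_metric x v u (c *\<^sub>R w) = c * D_metric x v u w"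
    using linear_cmul[OF linear_frechet_derivative[OF smooth_on_differentiable[OF smooth x, of v u]], of c w] by simp
  ultimately show "G x (christoffel G x v (c *\<^sub>R w)) u = G x (c *\<^sub>R christoffel G x v w) u"
    by (simp add: metric_christoffel[OF x] bilinear_lmul[OF bilinear] algebra_simps)
qed

lemma christoffel_zero:
  assumes x: "x \<in> U"
  shows "christoffel G x v 0 = 0" "christoffel G x 0 w = 0"
proof -
  show *: "christoffel G x v 0 = 0" for v
    using christoffel_scaleR[OF x, of v 0 0] by simp
  show "christoffel G x 0 w = 0"
    using christoffel_sym[OF x, of 0 w] * by simp
qed

text \<open>
  Adding the two Koszul formulas, the derivatives of the metric along \<open>v\<close> and along \<open>w\<close> cancel by
  symmetry and the two halves of the derivative along \<open>d\<close> remain.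
\<close>

lemma metric_compatible:
  assumes "x \<in> U"
  shows "G x (christoffel G x d v) w + G x v (christoffel G x d w) = D_metric x v w d"
  using assms
  by (simp add: metric_christoffel sym[OF assms, of v "christoffel G x d w"] D_metric_sym[OF assms, of w v]
     D_metric_sym[OF assms, of w d]  D_metric_sym[OF assms, of v d] field_simps)

text \<open>
  The product rule for a metric paired with a variable field, obtained by expanding the field in the
  standard basis because \<open>D_metric\<close> only involves constant fields.
\<close>

lemma has_derivative_metric_field:
  assumes x: "x \<in> U" and Z: "(Z has_derivative Z') (at x)"
  shows "((\<lambda>y. G y (Z y) u) has_derivative (\<lambda>d. D_metric x (Z x) u d + G x (Z' d) u)) (at x)"
proof -
  have expand: "G y z u = (\<Sum>c\<in>Basis. (z \<bullet> c) * G y c u)" if "y \<in> U" for y z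
    using positive_definite_form.left_expand[OF pos_def[OF that]] .
  have "((\<lambda>y. \<Sum>c\<in>Basis. (z \<bullet> c) * G y c u) has_derivative
      (\<lambda>d. \<Sum>c\<in>Basis. (z \<bullet> c) * D_metric x c u d)) (at x)" for z
    by (intro has_derivative_sum has_derivative_mult_right D_metric x)
  then have D_expand: "D_metric x z u = (\<lambda>d. \<Sum>c\<in>Basis. (z \<bullet> c) * D_metric x c u d)" for z
    by (rule D_metric_eqI[OF x]) (simp flip: expand)
  have "((\<lambda>y. \<Sum>c\<in>Basis. (Z y \<bullet> c) * G y c u) has_derivative
      (\<lambda>d. D_metric x (Z x) u d + G x (Z' d) u)) (at x)"
    by (rule derivative_eq_intros Z D_metric[OF x] refl)+
      (simp add: D_expand[of "Z x"] expand[OF x, of "Z' _"] sum.distrib)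
  then show ?thesis
    by (rule has_derivative_transform_within_open[OF _ open_U x]) (simp flip: expand)
qed

end

section \<open>Gradient and Hessian\<close>

lemma cov_deriv_const: "cov_deriv G v (\<lambda>_. w) = (\<lambda>x. christoffel G x v w)"
  by (simp add: cov_deriv_def fun_eq_iff)

locale function_chart = metric_chart U G
  for U :: "'e::euclidean_space set" and G +
  fixes F :: "'e \<Rightarrow> real"
  assumes smooth_F: "smooth_on U F"
begin

abbreviation dF :: "'e \<Rightarrow> 'e \<Rightarrow> real" where
  "dF x \<equiv> frechet_derivative F (at x)"

definition gradF :: "'e \<Rightarrow> 'e" where
  "gradF x = sharp (G x) (dF x)"

lemma dF: "x \<in> U \<Longrightarrow> (F has_derivative dF x) (at x)"
  using smooth_on_differentiable[OF smooth_F] frechet_derivative_works by blast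

lemma linear_dF: "x \<in> U \<Longrightarrow> linear (dF x)"
  using smooth_on_differentiable[OF smooth_F] linear_frechet_derivative by blast

lemma metric_gradF: "x \<in> U \<Longrightarrow> G x (gradF x) u = dF x u"
  unfolding gradF_def by (rule positive_definite_form.sharp_inner[OF pos_def linear_dF])

lemma gradF_differentiable: "x \<in> U \<Longrightarrow> gradF differentiable (at x)"
  unfolding gradF_def [abs_def]
  by (rule differentiable_sharp[OF open_U])
     (auto intro: pos_def smooth_on_continuous smooth smooth_on_differentiable linear_dF
        smooth_on_derivative_differentiable[OF smooth_F])

text \<open>
  The classical identity \<open>g(\<nabla>\<^sub>d grad F, u) = H\<^sup>F(d, u)\<close>: differentiate \<open>g(grad F, u) = dF(u)\<close> along
  \<open>d\<close> and use that the connection is metric.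
\<close>

lemma cov_deriv_gradF:
  assumes x: "x \<in> U"
  shows "cov_deriv G d gradF x = sharp (G x) (hessian_rep G F x d)"
proof -
  define Z' where "Z' = frechet_derivative gradF (at x)"
  have Z': "(gradF has_derivative Z') (at x)"
    unfolding Z'_def using gradF_differentiable[OF x] frechet_derivative_works by blast
  have "G x (Z' d + christoffel G x d (gradF x)) u = hessian_rep G F x d u" for u
  proof -
    have "((\<lambda>y. dF y u) has_derivative (\<lambda>d. D_metric x (gradF x) u d + G x (Z' d) u)) (at x)"
      using has_derivative_metric_field[OF x Z', of u]
      by (rule has_derivative_transform_within_open[OF _ open_U x]) (rule metric_gradF)
    then have "frechet_derivative (\<lambda>y. dF y u) (at x) d = D_metric x (gradF x) u d + G x (Z' d) u"
      by (simp flip: frechet_derivative_at)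
    moreover have "dF x (christoffel G x d u) = G x (gradF x) (christoffel G x d u)"
      using metric_gradF[OF x] by simp
    moreover have "G x (Z' d + christoffel G x d (gradF x)) u = G x (Z' d) u + G x (christoffel G x d (gradF x)) u"
      using positive_definite_form.left_linear[OF pos_def[OF x]] by (rule linear_add)
    ultimately show ?thesis
      using metric_compatible[OF x, of d "gradF x" u]
      by (simp add: hessian_rep_def cov_deriv_const)
  qed
  from positive_definite_form.sharp_unique[OF pos_def[OF x] this] show ?thesis
    by (simp add: cov_deriv_def Z'_def)
qed

end

section \<open>The static metric in a chart\<close>

text \<open>
  The product metric \<open>H\<close> is prescribed only over \<open>U\<close>, since the components of a tensor in a chart
  have arbitrary values outside the chart image.
\<close>

locale static_chart = function_chart U G F
  for U :: "'e::euclidean_space set" and G and F +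
  fixes H :: "'e \<times> real \<Rightarrow> 'e \<times> real \<Rightarrow> 'e \<times> real \<Rightarrow> real"
  assumes F_pos: "\<And>x. x \<in> U \<Longrightarrow> F x > 0"
    and H_eq: "\<And>x t v w. x \<in> U \<Longrightarrow> H (x, t) v w = G x (fst v) (fst w) - (F x)\<^sup>2 * (snd v * snd w)"
begin

lemma open_cylinder: "open (U \<times> (UNIV :: real set))"
  using open_U by (simp add: open_Times)

lemma has_derivative_space:
  assumes "(h has_derivative h') (at x)"
  shows "((\<lambda>p. h (fst p)) has_derivative (\<lambda>p. h' (fst p))) (at (x, t :: real))"
  using has_derivative_compose[OF has_derivative_fst[OF has_derivative_ident], of h h' "(x, t)" UNIV] assms
  by simp

lemma D_static_metric:
  assumes x: "x \<in> U"
  shows "frechet_derivative (\<lambda>p. H p v w) (at (x, t)) d =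
    D_metric x (fst v) (fst w) (fst d) - 2 * F x * dF x (fst d) * (snd v * snd w)"
proof -
  have "((\<lambda>p. G (fst p) (fst v) (fst w) - (F (fst p))\<^sup>2 * (snd v * snd w)) has_derivative
      (\<lambda>d. D_metric x (fst v) (fst w) (fst d) - 2 * F x * dF x (fst d) * (snd v * snd w))) (at (x, t))"
    by (rule derivative_eq_intros has_derivative_space D_metric dF x refl)+ (simp add: fun_eq_iff)
  then have "((\<lambda>p. H p v w) has_derivative
      (\<lambda>d. D_metric x (fst v) (fst w) (fst d) - 2 * F x * dF x (fst d) * (snd v * snd w))) (at (x, t))"
    by (rule has_derivative_transform_within_open[OF _ open_cylinder]) (auto simp: x H_eq)
  then show ?thesis
    by (simp flip: frechet_derivative_at)
qed

text \<open>
  \<open>H\<close> is indefinite, but nondegenerate, as the orthogonal sum of a positive definite form and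
  \<open>-F\<^sup>2 dt\<^sup>2\<close> with \<open>F \<noteq> 0\<close>.
\<close>

lemma sharp_static_metric:
  assumes x: "x \<in> U" and eq: "\<And>u. H (x, t) z u = \<omega> u"
  shows "sharp (H (x, t)) \<omega> = z"
proof (rule sharp_eqI)
  show "H (x, t) z u = \<omega> u" for u by (rule eq)
next
  interpret positive_definite_form "G x" using pos_def[OF x] .
  show "bilinear (H (x, t))"
    unfolding bilinear_def
    by (auto intro!: linearI simp: H_eq[OF x] bilinear_ladd[OF bilinear] bilinear_radd[OF bilinear]
         bilinear_lmul[OF bilinear] bilinear_rmul[OF bilinear] algebra_simps)
  fix z assume z: "\<And>u. H (x, t) z u = 0"
  have "G x (fst z) u = 0" for u
    using z[of "(u, 0)"] by (simp add: H_eq[OF x])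
  then have "fst z = 0"
    by (rule nondegenerate)
  moreover have "snd z = 0"
    using z[of "(0, 1)"] F_pos[OF x] by (simp add: H_eq[OF x] bilinear_rzero[OF bilinear])
  ultimately show "z = 0"
    by (simp add: prod_eq_iff)
qed

text \<open>
  The connection of a warped product, all components at once: verify the Koszul formula, which
  determines the Christoffel symbols by nondegeneracy.
\<close>

lemma christoffel_static_metric:
  assumes x: "x \<in> U"
  shows "christoffel H (x, t) (v, a) (w, b) =
    (christoffel G x v w + (a * b * F x) *\<^sub>R gradF x, (a * dF x w + b * dF x v) / F x)"
  unfolding christoffel_def[of H]
proof (rule sharp_static_metric[OF x])
  fix u :: "'e \<times> real"
  obtain y s where u: "u = (y, s)" by (cases u)
  interpret positive_definite_form "G x" using pos_def[OF x] .
  show "H (x, t) (christoffel G x v w + (a * b * F x) *\<^sub>R gradF x, (a * dF x w + b * dF x v) / F x) u =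
    (frechet_derivative (\<lambda>p. H p (w, b) u) (at (x, t)) (v, a)
     + frechet_derivative (\<lambda>p. H p (v, a) u) (at (x, t)) (w, b)
     - frechet_derivative (\<lambda>p. H p (v, a) (w, b)) (at (x, t)) u) / 2"
    using F_pos[OF x]
    by (simp add: u D_static_metric[OF x] H_eq[OF x] bilinear_ladd[OF bilinear] bilinear_lmul[OF bilinear]
         metric_christoffel[OF x] metric_gradF[OF x] field_simps power2_eq_square)
qed

text \<open>
  Since \<open>\<nabla>\<^sub>t \<partial>\<^sub>t = F grad F\<close> and \<open>\<nabla>\<^sub>d \<partial>\<^sub>t = (dF(d) / F) \<partial>\<^sub>t\<close>, the first iterated derivative is
  \<open>dF(d) grad F + F \<nabla>\<^sub>d grad F\<close> and the second one is \<open>dF(d) grad F\<close>.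
\<close>

lemma curvature_partial_t:
  assumes x: "x \<in> U"
  shows "curvature H (x, t) (d, 0) partial_t partial_t = (F x *\<^sub>R sharp (G x) (hessian_rep G F x d), 0)"
proof -
  have tt: "christoffel H p partial_t partial_t = (F (fst p) *\<^sub>R gradF (fst p), 0)"
    and dt: "christoffel H p (d, 0) partial_t = (0, dF (fst p) d / F (fst p))" if "p \<in> U \<times> UNIV" for p
    using that christoffel_static_metric christoffel_zero linear_dF
    by (auto simp: partial_t_def linear_0)
  define Z' where "Z' = frechet_derivative gradF (at x)"
  have Z': "(gradF has_derivative Z') (at x)"
    unfolding Z'_def using gradF_differentiable[OF x] frechet_derivative_works by blast
  have "((\<lambda>p. (F (fst p) *\<^sub>R gradF (fst p), 0 :: real)) has_derivative
      (\<lambda>h. (F x *\<^sub>R Z' (fst h) + dF x (fst h) *\<^sub>R gradF x, 0))) (at (x, t))"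
    by (rule derivative_eq_intros has_derivative_space Z' dF[OF x] refl)+ simp
  then have "((\<lambda>p. christoffel H p partial_t partial_t) has_derivative
      (\<lambda>h. (F x *\<^sub>R Z' (fst h) + dF x (fst h) *\<^sub>R gradF x, 0))) (at (x, t))"
    by (rule has_derivative_transform_within_open[OF _ open_cylinder]) (auto simp: x tt)
  then have D_tt: "frechet_derivative (\<lambda>p. christoffel H p partial_t partial_t) (at (x, t)) (d, 0) =
      (F x *\<^sub>R Z' d + dF x d *\<^sub>R gradF x, 0)"
    by (simp flip: frechet_derivative_at)
  \<comment> \<open>the coefficient of \<open>\<nabla>\<^sub>d \<partial>\<^sub>t\<close> is constant in \<open>t\<close>, so its derivative \<open>L\<close> is only evaluated at 0\<close>
  have "(\<lambda>y. dF y d / F y) differentiable (at x)"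
    using F_pos[OF x] smooth_on_derivative_differentiable[OF smooth_F x] smooth_on_differentiable[OF smooth_F x]
    by (intro differentiable_divide) auto
  then obtain L where L: "((\<lambda>y. dF y d / F y) has_derivative L) (at x)"
    by (auto simp: differentiable_def)
  then have "L 0 = 0"
    using has_derivative_linear linear_0 by blast
  have "((\<lambda>p. (0 :: 'e, dF (fst p) d / F (fst p))) has_derivative (\<lambda>h. (0, L (fst h)))) (at (x, t))"
    by (intro has_derivative_Pair has_derivative_const has_derivative_space L)
  then have "((\<lambda>p. christoffel H p (d, 0) partial_t) has_derivative (\<lambda>h. (0, L (fst h)))) (at (x, t))"
    by (rule has_derivative_transform_within_open[OF _ open_cylinder]) (auto simp: x dt)
  then have D_dt: "frechet_derivative (\<lambda>p. christoffel H p (d, 0) partial_t) (at (x, t)) partial_t = 0"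
    using \<open>L 0 = 0\<close> by (simp add: partial_t_def zero_prod_def flip: frechet_derivative_at)
  have "cov_deriv H (d, 0) (cov_deriv H partial_t (\<lambda>_. partial_t)) (x, t) =
      (F x *\<^sub>R Z' d + dF x d *\<^sub>R gradF x, 0) + christoffel H (x, t) (d, 0) (F x *\<^sub>R gradF x, 0)"
    by (simp add: cov_deriv_const) (simp add: cov_deriv_def D_tt tt x)
  also have "christoffel H (x, t) (d, 0) (F x *\<^sub>R gradF x, 0) = (F x *\<^sub>R christoffel G x d (gradF x), 0)"
    by (simp add: christoffel_static_metric[OF x] christoffel_scaleR[OF x])
  also have "(F x *\<^sub>R Z' d + dF x d *\<^sub>R gradF x, 0) + (F x *\<^sub>R christoffel G x d (gradF x), 0 :: real) =
      (F x *\<^sub>R cov_deriv G d gradF x + dF x d *\<^sub>R gradF x, 0)"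
    by (simp add: cov_deriv_def Z'_def algebra_simps)
  finally have 1: "cov_deriv H (d, 0) (cov_deriv H partial_t (\<lambda>_. partial_t)) (x, t) =
      (F x *\<^sub>R cov_deriv G d gradF x + dF x d *\<^sub>R gradF x, 0)" .
  have 2: "cov_deriv H partial_t (cov_deriv H (d, 0) (\<lambda>_. partial_t)) (x, t) = (dF x d *\<^sub>R gradF x, 0)"
    using F_pos[OF x]
    by (simp add: cov_deriv_const)
      (simp add: cov_deriv_def D_dt[unfolded partial_t_def] dt[unfolded partial_t_def] x partial_t_def
        christoffel_static_metric christoffel_zero linear_0 linear_dF)
  show ?thesis
    unfolding curvature_def 1 2 cov_deriv_gradF[OF x, symmetric] by simp
qed

text \<open>
  In the trace that defines the Ricci tensor the direction \<open>\<partial>\<^sub>t\<close> contributes nothing, as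
  \<open>R(\<partial>\<^sub>t, \<partial>\<^sub>t) = 0\<close>; the remaining directions sum to \<open>F\<close> times
  the trace of the Hessian.
\<close>

lemma ricci_partial_t:
  assumes x: "x \<in> U"
  shows "ricci_rep H (x, t) partial_t partial_t = F x * metric_trace (G x) (hessian_rep G F x)"
proof -
  have "curvature H (x, t) (0, 1) partial_t partial_t = 0"
    by (simp add: curvature_def partial_t_def)
  moreover have "(\<Sum>b\<in>Basis. h b) = (\<Sum>b\<in>Basis. h (b, 0)) + h (0, 1)" for h :: "'e \<times> real \<Rightarrow> real"
    unfolding Basis_prod_def by (subst sum.union_disjoint) (auto simp: sum.reindex inj_on_def)
  ultimately show ?thesis
    by (simp add: ricci_rep_def curvature_partial_t[OF x] metric_trace_def sum_distrib_left)
qed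

end

section \<open>From charts to the manifold\<close>

lemma chart_inj_on:
  assumes "smooth_manifold M" "i \<in> index M"
  shows "inj_on (chart M i) (chart_dom M i)"
proof -
  have "homeomorphic_map (subtopology (points M) (chart_dom M i)) (top_of_set (chart_image M i)) (chart M i)"
    and "openin (points M) (chart_dom M i)"
    using assms by (auto simp: smooth_manifold_def)
  then show ?thesis
    using homeomorphic_imp_injective_map openin_subset
    by (metis inf.absorb_iff2 topspace_subtopology)
qed

lemma chart_inv_times_line:
  assumes inj: "inj_on (chart M i) (chart_dom M i)" and x: "x \<in> chart_image M i"
  shows "chart_inv (times_line M) i (x, t) = (chart_inv M i x, t)"
  unfolding chart_inv_def
proof (rule inv_into_f_eq)
  show "inj_on (chart (times_line M) i) (chart_dom (times_line M) i)"
    using inj by (auto simp: times_line_def inj_on_def)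
  show "(inv_into (chart_dom M i) (chart M i) x, t) \<in> chart_dom (times_line M) i"
    and "chart (times_line M) i (inv_into (chart_dom M i) (chart M i) x, t) = (x, t)"
    using x by (auto simp: times_line_def chart_image_def inv_into_into f_inv_into_f)
qed

lemma static_chart_of_manifold:
  assumes M: "smooth_manifold M" and g: "riemannian_metric M g" and f: "smooth_function M f"
    and f_pos: "\<forall>p\<in>topspace (points M). f p > 0" and i: "i \<in> index M"
  shows "static_chart (chart_image M i) (tensor_rep M g i) (f \<circ> chart_inv M i)
    (tensor_rep (times_line M) (static_metric g f) i)"
proof
  have inv: "chart_inv M i x \<in> chart_dom M i" if "x \<in> chart_image M i" for x
    using that by (simp add: chart_inv_def chart_image_def inv_into_into)
  show "open (chart_image M i)"
    using M i by (simp add: smooth_manifold_def)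
  show "bilinear (tensor_rep M g i x)" if "x \<in> chart_image M i" for x
    unfolding tensor_rep_def
    using g i inv[OF that] unfolding riemannian_metric_def smooth_tensor2_def by blast
  show "tensor_rep M g i x v v > 0" if "x \<in> chart_image M i" "v \<noteq> 0" for x v
    unfolding tensor_rep_def
    using g i inv[OF that(1)] that(2) unfolding riemannian_metric_def by blast
  show "tensor_rep M g i x v w = tensor_rep M g i x w v" if "x \<in> chart_image M i" for x v w
    unfolding tensor_rep_def using g i inv[OF that] unfolding riemannian_metric_def by blast
  show "smooth_on (chart_image M i) (\<lambda>x. tensor_rep M g i x v w)" for v w
    using g i unfolding riemannian_metric_def smooth_tensor2_def by blast
  show "smooth_on (chart_image M i) (f \<circ> chart_inv M i)"
    using f i by (simp add: smooth_function_def)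
  show "(f \<circ> chart_inv M i) x > 0" if "x \<in> chart_image M i" for x
    using f_pos M i inv[OF that] by (auto simp: smooth_manifold_def)
  show "tensor_rep (times_line M) (static_metric g f) i (x, t) v w =
      tensor_rep M g i x (fst v) (fst w) - ((f \<circ> chart_inv M i) x)\<^sup>2 * (snd v * snd w)"
    if "x \<in> chart_image M i" for x t v w
    by (simp add: tensor_rep_def chart_inv_times_line[OF chart_inj_on[OF M i] that] static_metric_def)
qed

lemma ricci_static_partial_t:
  assumes "smooth_manifold M" "riemannian_metric M g" "smooth_function M f"
    and "\<forall>p\<in>topspace (points M). f p > 0" and i: "i \<in> index M" and p: "p \<in> chart_dom M i"
  shows "ricci (times_line M) (static_metric g f) i (p, t) partial_t partial_t = f p * laplacian M g f i p"
proof -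
  interpret static_chart "chart_image M i" "tensor_rep M g i" "f \<circ> chart_inv M i"
    "tensor_rep (times_line M) (static_metric g f) i"
    using assms(1-5) by (rule static_chart_of_manifold)
  have "chart_inv M i (chart M i p) = p"
    unfolding chart_inv_def using chart_inj_on[OF assms(1) i] p by (rule inv_into_f_f)
  moreover have "chart M i p \<in> chart_image M i"
    using p by (simp add: chart_image_def)
  moreover have "hessian M g f i p = hessian_rep (tensor_rep M g i) (f \<circ> chart_inv M i) (chart M i p)"
    by (simp add: hessian_def fun_eq_iff)
  ultimately show ?thesis
    using ricci_partial_t[of "chart M i p" t]
    by (simp add: ricci_def laplacian_def times_line_def tensor_rep_def[of M])
qed

theorem theorem3p3:
  fixes M :: "('i, 'm, 'e::euclidean_space) manifold_data"
    and g :: "('i, 'm, 'e) tensor2"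
    and f :: "'m \<Rightarrow> real"
    and lam \<phi> :: "'m \<times> real \<Rightarrow> real"
  assumes "smooth_manifold M"
    and "riemannian_metric M g"
    and "smooth_function M f"
    and "\<forall>p\<in>topspace (points M). f p > 0"
    and "vacuum_static M g f"
    and "almost_gradient_ricci_soliton (times_line M) (static_metric g f) lam \<phi>"
    and "\<forall>i\<in>index (times_line M). \<forall>q\<in>chart_dom (times_line M) i.
           hessian (times_line M) (static_metric g f) \<phi> i q partial_t partial_t = 0"
  shows "steady (times_line M) lam"
  unfolding steady_def
proof
  fix q assume q: "q \<in> topspace (points (times_line M))"
  obtain p t where pt: "q = (p, t)" by (cases q)
  have p: "p \<in> topspace (points M)"
    using q pt by (simp add: times_line_def)
  then obtain i where i: "i \<in> index M" "p \<in> chart_dom M i"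
    using assms(1) by (auto simp: smooth_manifold_def)
  then have i': "i \<in> index (times_line M)" "(p, t) \<in> chart_dom (times_line M) i"
    by (auto simp: times_line_def)
  have "laplacian M g f i p = 0"
    using assms(5) i by (simp add: vacuum_static_def)
  then have "ricci (times_line M) (static_metric g f) i (p, t) partial_t partial_t = 0"
    using ricci_static_partial_t[OF assms(1-4) i, of t] by simp
  moreover have "hessian (times_line M) (static_metric g f) \<phi> i (p, t) partial_t partial_t = 0"
    using assms(7) i' by blast
  moreover have "hessian (times_line M) (static_metric g f) \<phi> i (p, t) partial_t partial_t
      + ricci (times_line M) (static_metric g f) i (p, t) partial_t partial_t
      + lam (p, t) * static_metric g f i (p, t) partial_t partial_t = 0"
    using assms(6) i' unfolding almost_gradient_ricci_soliton_def by blast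
  moreover have "static_metric g f i (p, t) partial_t partial_t = - (f p)\<^sup>2"
  proof -
    have "bilinear (g i p)"
      using assms(2) i unfolding riemannian_metric_def smooth_tensor2_def by blast
    then show ?thesis
      by (simp add: static_metric_def partial_t_def bilinear_lzero)
  qed
  ultimately show "lam q = 0"
    using assms(4) p pt by auto
qed

end
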